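(* Let $\mathcal{H}$ be a complex Hilbert space and let $T,S$ be $EP$ operators on $\mathcal{H}$. If $A,B\in\mathcal{B}(\mathcal{H})$ satisfy $AT=SB$ and $AT^2=S^2B$, then $AT^\dagger=S^\dagger B$.
   Context: $\mathcal{B}(\mathcal{H})$ is the space of bounded linear operators on $\mathcal{H}$; $\mathcal{R}(T)$ denotes the range of $T$ and $T^*$ its adjoint. For $T\in\mathcal{B}(\mathcal{H})$ with closed range, the Moore-Penrose inverse $T^\dagger$ is the unique operator in $\mathcal{B}(\mathcal{H})$ satisfying $TT^\dagger T=T$, $T^\dagger TT^\dagger=T^\dagger$, $TT^\dagger=(TT^\dagger)^*$ and $T^\dagger T=(T^\dagger T)^*$. An $EP$ operator on $\mathcal{H}$ is a $T\in\mathcal{B}(\mathcal{H})$ with closed range such that $\mathcal{R}(T)=\mathcal{R}(T^* )$. *)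

theory Defs
  imports "HOL-Analysis.Analysis"
begin

(* Positive definiteness of the sesquilinear form, and the fact that it induces the norm, follow
   from real_inner together with inner_eq_Re_cinner and cinner_commute. *)
class complex_hilbert_space = real_inner + complete_space +
  fixes scaleC :: "complex \<Rightarrow> 'a \<Rightarrow> 'a" (infixr "*\<^sub>C" 75)
    and cinner :: "'a \<Rightarrow> 'a \<Rightarrow> complex"
  assumes scaleC_add_right: "c *\<^sub>C (x + y) = c *\<^sub>C x + c *\<^sub>C y"
    and scaleC_add_left: "(c + d) *\<^sub>C x = c *\<^sub>C x + d *\<^sub>C x"
    and scaleC_scaleC: "c *\<^sub>C d *\<^sub>C x = (c * d) *\<^sub>C x"
    and scaleC_of_real: "complex_of_real r *\<^sub>C x = r *\<^sub>R x"
    and cinner_add_left: "cinner (x + y) z = cinner x z + cinner y z"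
    and cinner_scaleC_left: "cinner (c *\<^sub>C x) y = c * cinner x y"
    and cinner_commute: "cinner x y = cnj (cinner y x)"
    and inner_eq_Re_cinner: "inner x y = Re (cinner x y)"

definition bounded_clinear :: "('a::complex_hilbert_space \<Rightarrow> 'a) \<Rightarrow> bool" where
  "bounded_clinear T \<longleftrightarrow> bounded_linear T \<and> (\<forall>c x. T (c *\<^sub>C x) = c *\<^sub>C T x)"

definition cadjoint :: "('a::complex_hilbert_space \<Rightarrow> 'a) \<Rightarrow> ('a \<Rightarrow> 'a)" where
  "cadjoint T = (THE T'. \<forall>x y. cinner (T x) y = cinner x (T' y))"

definition moore_penrose :: "('a::complex_hilbert_space \<Rightarrow> 'a) \<Rightarrow> ('a \<Rightarrow> 'a)" where
  "moore_penrose T = (THE X. bounded_clinear X \<and>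
     T \<circ> X \<circ> T = T \<and> X \<circ> T \<circ> X = X \<and>
     T \<circ> X = cadjoint (T \<circ> X) \<and> X \<circ> T = cadjoint (X \<circ> T))"

definition EP_operator :: "('a::complex_hilbert_space \<Rightarrow> 'a) \<Rightarrow> bool" where
  "EP_operator T \<longleftrightarrow> bounded_clinear T \<and> closed (range T) \<and> range T = range (cadjoint T)"

end

theory Submission
  imports Defs
begin

text \<open>
  For an EP operator \<open>T\<close> with range \<open>R\<close> the kernel is the orthogonal complement of
  \<open>range T\<^sup>* = R\<close>, so \<open>T\<close> vanishes on that complement and maps the closed subspace \<open>R\<close>
  bijectively onto itself. Inverting \<open>T\<close> on \<open>R\<close> after projecting onto \<open>R\<close> gives an operator \<open>X\<close>
  with \<open>T X = X T\<close>, both being the orthogonal projection onto \<open>R\<close>. By uniqueness \<open>X\<close> is the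
  Moore-Penrose inverse, which therefore is also the group inverse of \<open>T\<close>
  (\<open>EP_moore_penrose\<close>). From there on the claim is pure algebra with group
  inverses (\<open>group_inverse_intertwine\<close>): writing \<open>X\<close> and \<open>Y\<close> for the inverses of \<open>T\<close> and \<open>S\<close>,
  both \<open>A X\<close> and \<open>Y B\<close> are equal to \<open>Y Y A T\<close>.

  The analytic content is that \<open>X\<close> exists and is bounded. Orthogonal projections onto closed
  subspaces come from minimising the distance; they give the Riesz representation and thus
  adjoints. Boundedness of \<open>X\<close> means that \<open>T\<close> is bounded below on \<open>R\<close>. As every element of \<open>R\<close>
  has the form \<open>T\<^sup>* w\<close>, the vectors \<open>y \<in> R\<close> with \<open>norm (T y) \<le> 1\<close> satisfy
  \<open>\<bar>inner y (T\<^sup>* w)\<bar> \<le> norm w\<close>, so they form a weakly bounded set, and such a set is bounded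
  by Baire's theorem (\<open>weakly_bounded_imp_bounded\<close>).
\<close>

section \<open>Orthogonal projection and Riesz representation\<close>

text \<open>
  Without local compactness the nearest point of \<open>M\<close> has to be built as the limit of a
  minimising sequence, and the parallelogram law is what makes such a sequence Cauchy.
\<close>
lemma orthogonal_projection_exists:
  fixes M :: "'a::{real_inner,complete_space} set"
  assumes M: "subspace M" "closed M"
  shows "\<exists>p\<in>M. \<forall>m\<in>M. inner (x - p) m = 0"
proof -
  define d where "d = (INF m\<in>M. (norm (x - m))\<^sup>2)"
  have bdd: "bdd_below ((\<lambda>m. (norm (x - m))\<^sup>2) ` M)"
    by (intro bdd_belowI2[where m=0]) simp
  have ne: "M \<noteq> {}"
    using M(1) subspace_0 by blast
  have d_le: "d \<le> (norm (x - m))\<^sup>2" if "m \<in> M" for m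
    unfolding d_def using bdd that by (rule cINF_lower)
  have "\<exists>m\<in>M. (norm (x - m))\<^sup>2 < d + e" if "e > 0" for e
    using cINF_less_iff[OF ne bdd, of "d + e"] that by (simp add: d_def)
  then have "\<forall>n. \<exists>m. m \<in> M \<and> (norm (x - m))\<^sup>2 < d + inverse (real (Suc n))"
    by (metis inverse_positive_iff_positive of_nat_0_less_iff zero_less_Suc)
  then obtain s where sM: "\<And>n. s n \<in> M"
    and s: "\<And>n. (norm (x - s n))\<^sup>2 < d + inverse (real (Suc n))"
    by metis
  \<comment> \<open>The parallelogram law at the midpoint, which lies in \<open>M\<close>, controls \<open>s i - s j\<close>.\<close>
  have close: "(norm (s i - s j))\<^sup>2 \<le> 2 * inverse (real (Suc i)) + 2 * inverse (real (Suc j))" for i j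
  proof -
    have "(1/2) *\<^sub>R (s i + s j) \<in> M"
      using M(1) sM by (simp add: subspace_add subspace_scale)
    then have "d \<le> (norm (x - (1/2) *\<^sub>R (s i + s j)))\<^sup>2"
      by (rule d_le)
    moreover have "(norm (s i - s j))\<^sup>2 = 2 * (norm (x - s i))\<^sup>2 + 2 * (norm (x - s j))\<^sup>2
        - 4 * (norm (x - (1/2) *\<^sub>R (s i + s j)))\<^sup>2"
      unfolding power2_norm_eq_inner
      by (simp add: inner_diff_left inner_diff_right inner_add_left inner_add_right
          inner_commute field_simps)
    ultimately show ?thesis
      using s[of i] s[of j] by linarith
  qed
  have "Cauchy s"
  proof (rule metric_CauchyI)
    fix e :: real assume e: "0 < e"
    then obtain N where N: "inverse (real (Suc N)) < e\<^sup>2 / 4"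
      using reals_Archimedean[of "e\<^sup>2 / 4"] by auto
    have "dist (s i) (s j) < e" if "i \<ge> N" "j \<ge> N" for i j
    proof -
      have "inverse (real (Suc i)) \<le> inverse (real (Suc N))"
           "inverse (real (Suc j)) \<le> inverse (real (Suc N))"
        using that by (simp_all add: field_simps)
      then have "(norm (s i - s j))\<^sup>2 < e\<^sup>2"
        using close[of i j] N by linarith
      then show ?thesis
        using e by (simp add: dist_norm power2_less_imp_less)
    qed
    then show "\<exists>N. \<forall>i\<ge>N. \<forall>j\<ge>N. dist (s i) (s j) < e"
      by blast
  qed
  then obtain p where p: "s \<longlonglongrightarrow> p"
    using Cauchy_convergent convergent_def by blast
  have pM: "p \<in> M"
    using M(2) sM p closed_sequentially by blast
  have "(\<lambda>n. (norm (x - s n))\<^sup>2) \<longlonglongrightarrow> (norm (x - p))\<^sup>2"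
    by (intro tendsto_intros p)
  moreover have "(\<lambda>n. d + inverse (real (Suc n))) \<longlonglongrightarrow> d + 0"
    by (intro tendsto_intros LIMSEQ_inverse_real_of_nat)
  ultimately have "(norm (x - p))\<^sup>2 \<le> d + 0"
    by (rule LIMSEQ_le) (use s less_imp_le in blast)
  then have p_le: "(norm (x - p))\<^sup>2 \<le> d"
    by simp
  have "inner (x - p) m = 0" if m: "m \<in> M" for m
  proof (cases "m = 0")
    case False
    \<comment> \<open>This \<open>t\<close> minimises the norm of \<open>x - p - t m\<close>.\<close>
    define t where "t = inner (x - p) m / inner m m"
    have mm: "inner m m > 0"
      using False by simp
    have "p + t *\<^sub>R m \<in> M"
      using M(1) pM m by (simp add: subspace_add subspace_scale)
    from d_le[OF this] p_le have "(norm (x - p))\<^sup>2 \<le> (norm ((x - p) - t *\<^sub>R m))\<^sup>2"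
      unfolding diff_diff_eq by linarith
    also have "\<dots> = (norm (x - p))\<^sup>2 - 2 * t * inner (x - p) m + t * (t * inner m m)"
      unfolding power2_norm_eq_inner
      by (simp add: inner_diff_left[of "x - p"] inner_diff_right[of _ "x - p"] right_diff_distrib
          inner_commute[of m "x - p"])
    also have "t * inner m m = inner (x - p) m"
      using mm by (simp add: t_def)
    finally have "t * inner (x - p) m \<le> 0"
      by simp
    then have "(inner (x - p) m)\<^sup>2 \<le> 0"
      using mm by (simp add: t_def power2_eq_square divide_le_0_iff)
    then show ?thesis
      by simp
  qed simp
  with pM show ?thesis
    by blast
qed

text \<open>
  The orthogonal complement of the kernel of a nonzero functional is a line; any nonzero vector
  \<open>u\<close> on it represents the functional up to a scalar.
\<close>
lemma riesz_representation:
  fixes f :: "'a::{real_inner,complete_space} \<Rightarrow> real"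
  assumes f: "bounded_linear f"
  shows "\<exists>y. \<forall>x. f x = inner x y"
proof (cases "\<forall>x. f x = 0")
  case True
  then show ?thesis
    by (metis inner_zero_right)
next
  case False
  note linear = linear_simps[OF f]
  from False obtain x0 where x0: "f x0 \<noteq> 0"
    by blast
  have "subspace {x. f x = 0}"
    by (simp add: subspace_def linear)
  moreover have "closed {x. f x = 0}"
    by (intro closed_Collect_eq continuous_on_const linear_continuous_on f)
  ultimately obtain p where p: "f p = 0" "\<And>m. f m = 0 \<Longrightarrow> inner (x0 - p) m = 0"
    using orthogonal_projection_exists[of "{x. f x = 0}" x0] by blast
  define u where "u = x0 - p"
  have fu: "f u \<noteq> 0"
    using x0 p(1) by (simp add: u_def linear)
  then have u: "inner u u \<noteq> 0"
    using linear(3) by auto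
  have "f x = inner x ((f u / inner u u) *\<^sub>R u)" for x
  proof -
    have "f (x - (f x / f u) *\<^sub>R u) = 0"
      using fu by (simp add: linear)
    then have "inner u (x - (f x / f u) *\<^sub>R u) = 0"
      using p(2) by (simp add: u_def)
    then show ?thesis
      using fu u by (simp add: inner_diff_right inner_commute[of u x] field_simps)
  qed
  then show ?thesis
    by blast
qed

section \<open>Uniform boundedness\<close>

text \<open>
  The uniform boundedness principle for the functionals \<open>inner y\<close>: the closed sets on which all
  of them are bounded by \<open>n\<close> cover the space, so one of them contains a ball.
\<close>
lemma weakly_bounded_imp_bounded:
  fixes Y :: "'a::{real_inner,complete_space} set"
  assumes Y: "\<And>z. \<exists>k. \<forall>y\<in>Y. \<bar>inner y z\<bar> \<le> k"
  shows "bounded Y"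
proof -
  define F where "F n = {z. \<forall>y\<in>Y. \<bar>inner y z\<bar> \<le> real n}" for n :: nat
  have closed: "closed (F n)" for n
    unfolding F_def Collect_ball_eq
    by (intro closed_INT ballI closed_Collect_le continuous_intros)
  have cover: "(\<Union>n. F n) = UNIV"
  proof -
    have "\<exists>n. z \<in> F n" for z
    proof -
      obtain k where k: "\<forall>y\<in>Y. \<bar>inner y z\<bar> \<le> k"
        using Y by blast
      obtain n where "k \<le> real n"
        using real_arch_simple by blast
      with k have "z \<in> F n"
        by (force simp: F_def)
      then show ?thesis
        by blast
    qed
    then show ?thesis
      by blast
  qed
  have "\<exists>n. interior (F n) \<noteq> {}"
  proof (rule ccontr)
    assume "\<not> ?thesis"
    then have "interior (\<Union>(range F)) = {}"
      using Met_TC.metric_Baire_category_alt[where \<G> = "range F"] closed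
      by (auto simp: complete_UNIV)
    with cover show False
      by simp
  qed
  then obtain n z e where e: "e > 0" and ball: "cball z e \<subseteq> F n"
    by (metis ex_in_conv mem_interior_cball)
  have "norm y \<le> 2 * real n / e" if y: "y \<in> Y" for y
  proof (cases "y = 0")
    case False
    \<comment> \<open>Move from the centre by \<open>e\<close> in the direction of \<open>y\<close>.\<close>
    have "z + (e / norm y) *\<^sub>R y \<in> F n" "z \<in> F n"
      using e False by (auto intro!: subsetD[OF ball] simp: dist_norm)
    then have "\<bar>inner y (z + (e / norm y) *\<^sub>R y)\<bar> \<le> real n" "\<bar>inner y z\<bar> \<le> real n"
      using y by (auto simp: F_def)
    moreover have "inner y (z + (e / norm y) *\<^sub>R y) = inner y z + e * norm y"
      using False by (simp add: inner_add_right dot_square_norm power2_eq_square)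
    ultimately have "e * norm y \<le> 2 * real n"
      by linarith
    then show ?thesis
      using e by (simp add: field_simps)
  qed (use e in simp)
  then show ?thesis
    by (auto simp: bounded_iff)
qed

section \<open>The complex inner product and adjoints\<close>

lemma cinner_add_right: "cinner x (y + z) = cinner x y + cinner x z"
  by (subst (1 2 3) cinner_commute) (simp add: cinner_add_left)

lemma cinner_scaleC_right: "cinner x (c *\<^sub>C y) = cnj c * cinner x y"
  by (subst (1 2) cinner_commute) (simp add: cinner_scaleC_left)

lemma cinner_diff_left: "cinner (x - y) z = cinner x z - cinner y z"
  using cinner_add_left[of "x - y" y z] by simp

lemma cinner_diff_right: "cinner x (y - z) = cinner x y - cinner x z"
  using cinner_add_right[of x "y - z" z] by simp

lemma cinner_zero_left: "cinner 0 z = 0"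
  using cinner_diff_left[of 0 0 z] by simp

lemma cinner_self_eq_0: "cinner x x = 0 \<Longrightarrow> x = 0"
  using inner_eq_Re_cinner[of x x] by simp

lemma scaleC_diff_right: "c *\<^sub>C (x - y) = c *\<^sub>C x - c *\<^sub>C y"
  using scaleC_add_right[of c "x - y" y] by simp

text \<open>
  The imaginary part is again a real inner product, which lets identities be transferred from
  \<open>inner\<close> to \<open>cinner\<close> by complex linearity.
\<close>
lemma Im_cinner: "Im (cinner x y) = - inner (\<i> *\<^sub>C x) y"
  by (simp add: inner_eq_Re_cinner cinner_scaleC_left)

lemma cinner_ext:
  assumes "\<And>z. cinner z x = cinner z y"
  shows "x = y"
  using cinner_self_eq_0[of "x - y"] assms by (simp add: cinner_diff_right)

lemma bounded_clinear_add: "bounded_clinear T \<Longrightarrow> T (x + y) = T x + T y"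
  by (simp add: bounded_clinear_def linear_simps)

lemma bounded_clinear_diff: "bounded_clinear T \<Longrightarrow> T (x - y) = T x - T y"
  by (simp add: bounded_clinear_def linear_simps)

lemma bounded_clinear_scaleC: "bounded_clinear T \<Longrightarrow> T (c *\<^sub>C x) = c *\<^sub>C T x"
  by (simp add: bounded_clinear_def)

lemma bounded_clinear_compose:
  "bounded_clinear S \<Longrightarrow> bounded_clinear T \<Longrightarrow> bounded_clinear (S \<circ> T)"
  by (simp add: bounded_clinear_def bounded_linear_compose o_def)

lemma cadjoint_eqI:
  assumes "\<And>x y. cinner (T x) y = cinner x (T' y)"
  shows "cadjoint T = T'"
  unfolding cadjoint_def
proof (rule the_equality)
  fix G assume "\<forall>x y. cinner (T x) y = cinner x (G y)"
  with assms show "G = T'"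
    by (intro ext cinner_ext) metis
qed (use assms in blast)

text \<open>
  The real Riesz representation already suffices for the existence of the adjoint: complex
  linearity of \<open>T\<close> turns a real adjoint into a complex one.
\<close>
lemma cinner_cadjoint:
  assumes T: "bounded_clinear T"
  shows "cinner (T x) y = cinner x (cadjoint T y)"
proof -
  have "\<exists>w. \<forall>x. inner (T x) y = inner x w" for y
    using T by (intro riesz_representation bounded_linear_intros)
      (simp_all add: bounded_clinear_def bounded_linear_compose[OF bounded_linear_inner_left])
  then obtain G where G: "\<And>x y. inner (T x) y = inner x (G y)"
    by metis
  have *: "cinner (T x) y = cinner x (G y)" for x y
  proof (rule complex_eqI)
    show "Re (cinner (T x) y) = Re (cinner x (G y))"
      using G by (simp add: inner_eq_Re_cinner)
    show "Im (cinner (T x) y) = Im (cinner x (G y))"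
      using G[of "\<i> *\<^sub>C x" y] by (simp add: Im_cinner bounded_clinear_scaleC[OF T])
  qed
  from cadjoint_eqI[of T G, OF *] * show ?thesis
    by simp
qed

section \<open>The Moore-Penrose inverse of an EP operator\<close>

text \<open>
  The adjoint of \<open>P Q\<close> is \<open>Q P\<close>. So if one of the two products is \<open>P\<close> and the other one is
  \<open>Q\<close>, then \<open>P\<close> and \<open>Q\<close> are adjoint to each other, hence equal. For orthogonal projections this
  says that they are determined by their range, and also by their kernel; the two cases of the
  last premise serve these two uses.
\<close>
lemma selfadjoint_eqI:
  assumes P: "bounded_clinear P" "P = cadjoint P"
    and Q: "bounded_clinear Q" "Q = cadjoint Q"
    and PQ: "P \<circ> Q = R" and QP: "Q \<circ> P = S" and RS: "R = P \<and> S = Q \<or> R = Q \<and> S = P"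
  shows "P = Q"
proof -
  have P': "cinner (P x) y = cinner x (P y)" and Q': "cinner (Q x) y = cinner x (Q y)" for x y
    using cinner_cadjoint[OF P(1), of x y] cinner_cadjoint[OF Q(1), of x y] P(2) Q(2) by simp_all
  have "cinner x (R y) = cinner (S x) y" for x y
    using PQ QP by (auto simp: P' Q')
  with RS show ?thesis
    by (intro ext cinner_ext) (metis P' Q')
qed

text \<open>
  \<open>T X\<close> and \<open>T Y\<close> are self-adjoint idempotents with the range of \<open>T\<close>, while \<open>X T\<close> and \<open>Y T\<close>
  are such with the kernel of \<open>T\<close>, so they agree in pairs.
\<close>
lemma moore_penrose_unique:
  assumes T: "bounded_clinear T"
    and X: "bounded_clinear X" "T \<circ> X \<circ> T = T" "X \<circ> T \<circ> X = X"
      "T \<circ> X = cadjoint (T \<circ> X)" "X \<circ> T = cadjoint (X \<circ> T)"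
    and Y: "bounded_clinear Y" "T \<circ> Y \<circ> T = T" "Y \<circ> T \<circ> Y = Y"
      "T \<circ> Y = cadjoint (T \<circ> Y)" "Y \<circ> T = cadjoint (Y \<circ> T)"
  shows "Y = X"
proof -
  have TX: "T \<circ> X = T \<circ> Y"
    by (rule selfadjoint_eqI[where R="T \<circ> Y" and S="T \<circ> X"])
      (use T X Y in \<open>auto intro: bounded_clinear_compose simp flip: comp_assoc\<close>)
  have XT: "X \<circ> T = Y \<circ> T"
    by (rule selfadjoint_eqI[where R="X \<circ> T" and S="Y \<circ> T"])
      (use T X Y in \<open>auto intro: bounded_clinear_compose simp: comp_assoc\<close>)
  have "Y = Y \<circ> T \<circ> Y"
    by (rule Y(3)[symmetric])
  also have "\<dots> = X \<circ> T \<circ> Y"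
    by (simp only: XT)
  also have "\<dots> = X \<circ> T \<circ> X"
    by (simp only: comp_assoc TX)
  also have "\<dots> = X"
    by (rule X(3))
  finally show ?thesis .
qed

text \<open>
  With \<open>R = range T\<close>, \<open>X x\<close> is the point \<open>y\<close> of \<open>R\<close> for which \<open>T y\<close> is the orthogonal projection of \<open>x\<close> onto \<open>R\<close>.
  It is determined by \<open>y \<in> R\<close> and \<open>x - T y\<close> being orthogonal to \<open>R\<close>, and this
  characterisation yields its linearity and its algebraic properties.
\<close>
lemma EP_group_inverse:
  assumes EP: "EP_operator T"
  obtains X where "bounded_clinear X" "T \<circ> X \<circ> T = T" "X \<circ> T \<circ> X = X" "T \<circ> X = X \<circ> T"
    "cadjoint (T \<circ> X) = T \<circ> X"
proof -
  define R where "R = range T"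
  have T: "bounded_clinear T" and closed: "closed R" and R: "R = range (cadjoint T)"
    using EP by (auto simp: EP_operator_def R_def)
  note adj = cinner_cadjoint[OF T]
  note T_simps = bounded_clinear_add[OF T] bounded_clinear_diff[OF T] bounded_clinear_scaleC[OF T]
  have TR [simp]: "T x \<in> R" for x
    by (simp add: R_def)
  have R_add: "x + y \<in> R" and R_diff: "x - y \<in> R" and R_scaleC: "c *\<^sub>C x \<in> R"
    if "x \<in> R" "y \<in> R" for x y c
    using that by (auto simp: R_def simp flip: T_simps)
  have subspace: "subspace R"
    using T unfolding R_def bounded_clinear_def
    by (intro linear_subspace_image subspace_UNIV bounded_linear.linear) auto
  have proj: "\<exists>p\<in>R. \<forall>r\<in>R. cinner (x - p) r = 0" for x
  proof -
    obtain p where p: "p \<in> R" "\<And>r. r \<in> R \<Longrightarrow> inner (x - p) r = 0"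
      using orthogonal_projection_exists[OF subspace closed] by blast
    have "cinner (x - p) r = 0" if "r \<in> R" for r
      using p(2)[OF that] p(2)[OF R_scaleC[OF that that, of \<i>]]
      by (simp add: inner_eq_Re_cinner cinner_scaleC_right complex_eq_iff)
    with p(1) show ?thesis
      by blast
  qed
  \<comment> \<open>\<open>T\<^sup>* T q\<close> lies in \<open>R\<close>, so \<open>q\<close> is orthogonal to it.\<close>
  have ker: "T q = 0" if "\<forall>r\<in>R. cinner q r = 0" for q
    using that adj[of q "T q"] R by (intro cinner_self_eq_0) auto
  have inj: "y = 0" if yR: "y \<in> R" and Ty: "T y = 0" for y
  proof -
    obtain w where "y = cadjoint T w"
      using yR R by blast
    then show ?thesis
      using adj[of y w] Ty by (intro cinner_self_eq_0) (simp add: cinner_zero_left)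
  qed
  have "\<exists>y. y \<in> R \<and> (\<forall>r\<in>R. cinner (x - T y) r = 0)" for x
  proof -
    obtain u where u: "\<forall>r\<in>R. cinner (x - T u) r = 0"
      using proj[of x] by (auto simp: R_def)
    obtain y where y: "y \<in> R" "\<forall>r\<in>R. cinner (u - y) r = 0"
      using proj[of u] by blast
    have "T u = T y"
      using ker[OF y(2)] by (simp add: T_simps)
    with u y(1) show ?thesis
      by auto
  qed
  then obtain X where XR: "\<And>x. X x \<in> R" and X: "\<And>x r. r \<in> R \<Longrightarrow> cinner (x - T (X x)) r = 0"
    by metis
  have X_eqI: "X x = y" if y: "y \<in> R" "\<And>r. r \<in> R \<Longrightarrow> cinner (x - T y) r = 0" for x y
  proof -
    have "cinner (T (X x - y)) r = 0" if "r \<in> R" for r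
      using y(2)[OF that] X[OF that, of x] by (simp add: T_simps cinner_diff_left)
    then have "T (X x - y) = 0"
      by (intro cinner_self_eq_0) simp
    with inj[OF R_diff[OF XR y(1)]] have "X x - y = 0" .
    then show ?thesis
      by simp
  qed
  have X_add: "X (x + y) = X x + X y" for x y
  proof (rule X_eqI)
    fix r assume "r \<in> R"
    from X[OF this, of x] X[OF this, of y]
    show "cinner (x + y - T (X x + X y)) r = 0"
      by (simp add: T_simps cinner_diff_left cinner_add_left)
  qed (simp add: R_add XR)
  have X_scaleC: "X (c *\<^sub>C x) = c *\<^sub>C X x" for c x
  proof (rule X_eqI)
    fix r assume "r \<in> R"
    from X[OF this, of x]
    show "cinner (c *\<^sub>C x - T (c *\<^sub>C X x)) r = 0"
      by (simp add: T_simps cinner_scaleC_left flip: scaleC_diff_right)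
  qed (rule R_scaleC[OF XR XR])
  have T_scaleR: "T (c *\<^sub>R x) = c *\<^sub>R T x" for c x
    using T by (simp add: bounded_clinear_def linear_simps)
  \<comment> \<open>For \<open>y \<in> R\<close> the product \<open>cinner y z\<close> depends only on the projection \<open>T\<^sup>* w\<close> of \<open>z\<close> onto \<open>R\<close>.\<close>
  have "bounded {y \<in> R. norm (T y) \<le> 1}"
  proof (rule weakly_bounded_imp_bounded)
    fix z
    obtain w where w: "\<forall>r\<in>R. cinner (z - cadjoint T w) r = 0"
      using proj[of z] R by auto
    have "\<bar>inner y z\<bar> \<le> norm w" if y: "y \<in> R" "norm (T y) \<le> 1" for y
    proof -
      have "cinner z y = cinner (cadjoint T w) y"
        using w y(1) by (simp add: cinner_diff_left)
      then have "cinner y z = cinner (T y) w"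
        by (metis adj cinner_commute)
      then have "\<bar>inner y z\<bar> \<le> norm (T y) * norm w"
        using Cauchy_Schwarz_ineq2[of "T y" w] by (simp add: inner_eq_Re_cinner)
      also have "\<dots> \<le> 1 * norm w"
        using y(2) by (intro mult_right_mono) auto
      finally show ?thesis
        by simp
    qed
    then show "\<exists>k. \<forall>y\<in>{y \<in> R. norm (T y) \<le> 1}. \<bar>inner y z\<bar> \<le> k"
      by blast
  qed
  then obtain C where C: "\<And>y. y \<in> R \<Longrightarrow> norm (T y) \<le> 1 \<Longrightarrow> norm y \<le> C"
    by (auto simp: bounded_iff)
  have lower: "norm y \<le> C * norm (T y)" if y: "y \<in> R" for y
  proof (cases "T y = 0")
    case False
    have "norm ((1 / norm (T y)) *\<^sub>R y) \<le> C"
      using False y subspace by (intro C) (auto simp: subspace_scale T_scaleR)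
    then show ?thesis
      using False by (simp add: field_simps)
  qed (use inj[OF y] in simp)
  have contr: "norm (T (X x)) \<le> norm x" for x
  proof -
    have "inner (x - T (X x)) (T (X x)) = 0"
      using X[of "T (X x)" x] by (simp add: inner_eq_Re_cinner)
    then have "(norm (T (X x)))\<^sup>2 = inner x (T (X x))"
      by (simp add: inner_diff_left power2_norm_eq_inner)
    also have "\<dots> \<le> norm x * norm (T (X x))"
      by (rule norm_cauchy_schwarz)
    finally show ?thesis
      by (cases "T (X x) = 0") (simp_all add: power2_eq_square)
  qed
  have "C \<ge> 0"
    using C[of 0] subspace T_scaleR[of 0 0] by (simp add: subspace_0)
  have "bounded_linear X"
  proof (rule bounded_linear_intro[where K = C])
    show "X (r *\<^sub>R x) = r *\<^sub>R X x" for r x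
      using X_scaleC[of "complex_of_real r" x] by (simp add: scaleC_of_real)
    show "norm (X x) \<le> norm x * C" for x
      using lower[OF XR, of x] mult_left_mono[OF contr[of x] \<open>C \<ge> 0\<close>]
      by (simp add: mult.commute)
  qed (rule X_add)
  then have 1: "bounded_clinear X"
    by (simp add: bounded_clinear_def X_scaleC)
  have "T x - T (X (T x)) = 0" for x
    by (intro cinner_self_eq_0 X R_diff) auto
  then have 2: "T \<circ> X \<circ> T = T"
    by (auto simp: fun_eq_iff)
  have 3: "X \<circ> T \<circ> X = X"
    by (auto simp: fun_eq_iff XR cinner_zero_left intro!: X_eqI)
  have "X (T x) = T (X x)" for x
  proof (rule X_eqI)
    have "T (x - T (X x)) = 0"
      using X by (intro ker) blast
    then show "cinner (T x - T (T (X x))) r = 0" for r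
      by (simp add: T_simps cinner_zero_left)
  qed simp
  then have 4: "T \<circ> X = X \<circ> T"
    by (auto simp: fun_eq_iff)
  have 5: "cadjoint (T \<circ> X) = T \<circ> X"
  proof (rule cadjoint_eqI)
    fix x y
    have "cinner (y - T (X y)) (T (X x)) = 0" "cinner (x - T (X x)) (T (X y)) = 0"
      by (simp_all add: X)
    then show "cinner ((T \<circ> X) x) y = cinner x ((T \<circ> X) y)"
      using cinner_commute[of "T (X x)" y] cinner_commute[of "T (X x)" "T (X y)"]
      by (simp add: cinner_diff_left)
  qed
  from 1 2 3 4 5 show ?thesis
    by (rule that)
qed

lemma EP_moore_penrose:
  assumes EP: "EP_operator T"
  shows "T \<circ> moore_penrose T \<circ> T = T"
    and "moore_penrose T \<circ> T \<circ> moore_penrose T = moore_penrose T"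
    and "T \<circ> moore_penrose T = moore_penrose T \<circ> T"
proof -
  have T: "bounded_clinear T"
    using EP by (simp add: EP_operator_def)
  obtain X where X: "bounded_clinear X" "T \<circ> X \<circ> T = T" "X \<circ> T \<circ> X = X" "T \<circ> X = X \<circ> T"
    "cadjoint (T \<circ> X) = T \<circ> X"
    by (rule EP_group_inverse[OF EP])
  have adj: "T \<circ> X = cadjoint (T \<circ> X)" "X \<circ> T = cadjoint (X \<circ> T)"
    using X(4,5) by simp_all
  have "moore_penrose T = X"
    unfolding moore_penrose_def
  proof (rule the_equality)
    fix Y assume "bounded_clinear Y \<and> T \<circ> Y \<circ> T = T \<and> Y \<circ> T \<circ> Y = Y \<and>
      T \<circ> Y = cadjoint (T \<circ> Y) \<and> Y \<circ> T = cadjoint (Y \<circ> T)"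
    then show "Y = X"
      using moore_penrose_unique[OF T X(1-3) adj, of Y] by blast
  qed (use X adj in blast)
  with X show "T \<circ> moore_penrose T \<circ> T = T"
    "moore_penrose T \<circ> T \<circ> moore_penrose T = moore_penrose T"
    "T \<circ> moore_penrose T = moore_penrose T \<circ> T"
    by simp_all
qed

section \<open>Intertwining\<close>

text \<open>
  The two hypotheses on \<open>A\<close> and \<open>B\<close> combine to \<open>S A T = S S B = A T T\<close>. As \<open>X = T X X\<close> and
  \<open>Y = Y Y S\<close>, factors of \<open>T\<close> next to \<open>X\<close> on the right of \<open>A\<close> can be traded for factors of
  \<open>S\<close> next to \<open>Y\<close> on the left, until no \<open>X\<close> remains.
\<close>
lemma group_inverse_intertwine:
  assumes X: "T \<circ> X \<circ> T = T" "X \<circ> T \<circ> X = X" "T \<circ> X = X \<circ> T"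
    and Y: "S \<circ> Y \<circ> S = S" "Y \<circ> S \<circ> Y = Y" "S \<circ> Y = Y \<circ> S"
    and AT: "A \<circ> T = S \<circ> B" and ATT: "A \<circ> T \<circ> T = S \<circ> S \<circ> B"
  shows "A \<circ> X = Y \<circ> B"
proof -
  note X' = X[unfolded fun_eq_iff comp_apply, rule_format]
  note Y' = Y[unfolded fun_eq_iff comp_apply, rule_format]
  note AT' = AT[unfolded fun_eq_iff comp_apply, rule_format]
  note ATT' = ATT[unfolded fun_eq_iff comp_apply, rule_format]
  have TXX: "T (X (X x)) = X x" for x
    using X'(2,3) by metis
  have YYS: "Y (Y (S x)) = Y x" for x
    using Y'(2,3) by metis
  have SAT: "S (A (T x)) = A (T (T x))" for x
    by (metis AT' ATT')
  have "A (X x) = Y (B x)" for x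
  proof -
    \<comment> \<open>\<open>A X x = A T X X x = S B X X x\<close> lies in the range of \<open>S\<close>, on which \<open>Y S\<close> is the identity.\<close>
    have "A (X x) = S (B (X (X x)))"
      by (metis TXX AT')
    then have "A (X x) = Y (S (A (X x)))"
      by (metis Y'(1,3))
    also have "S (A (X x)) = A (T (X x))"
      by (metis SAT TXX)
    also have "Y (A (T (X x))) = Y (Y (S (A (T (X x)))))"
      by (simp only: YYS)
    also have "S (A (T (X x))) = A (T x)"
      by (metis SAT X'(1,3))
    also have "A (T x) = S (B x)"
      by (rule AT')
    also have "Y (Y (S (B x))) = Y (B x)"
      by (rule YYS)
    finally show ?thesis .
  qed
  then show ?thesis
    by (simp add: fun_eq_iff)
qed

theorem theorem3p17:
  fixes T S A B :: "'a::complex_hilbert_space \<Rightarrow> 'a"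
  assumes "EP_operator T" and "EP_operator S"
    and "bounded_clinear A" and "bounded_clinear B"
    and "A \<circ> T = S \<circ> B"
    and "A \<circ> (T ^^ 2) = (S ^^ 2) \<circ> B"
  shows "A \<circ> moore_penrose T = moore_penrose S \<circ> B"
proof (rule group_inverse_intertwine)
  show "A \<circ> T \<circ> T = S \<circ> S \<circ> B"
    using assms(6) by (simp add: numeral_2_eq_2 comp_assoc)
qed (use assms EP_moore_penrose in auto)

end
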